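(* Let $A,B\in gl(2,\mathbb{R})$. The bilinear control system $\Sigma:\ \dot{x}=(A+uB)x$ is controllable on $\mathbb{R}^2\smallsetminus\{0\}$ if the following three conditions hold: (1) $\det(A)\det[A,B]>0$ or $\det(B)\det[A,B]>0$; (2) there exists $u\in\mathbb{R}$ such that $\Delta(u)<0$ (i.e. $A+uB$ has a complex, non-real, eigenvalue); and (3) $\mathrm{tr}(B)=0$.
   Context: $[A,B]=AB-BA$. For $u\in\mathbb{R}$, $\Delta(u)=(\mathrm{tr}(A+uB))^2-4\det(A+uB)$. Admissible controls are the piecewise constant functions $u:\mathbb{R}\to\mathbb{R}$ (finitely many jumps on each bounded interval). $\Sigma$ is controllable on $\mathbb{R}^2\smallsetminus\{0\}$ if for any $x,y\in\mathbb{R}^2\smallsetminus\{0\}$ there exist an admissible control $u$ and a time $T\ge0$ such that the solution of $\dot{x}(t)=(A+u(t)B)x(t)$ with $x(0)=x$ satisfies $x(T)=y$. *)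

theory Defs
  imports "HOL-Analysis.Analysis"
begin

definition commutator :: "real^2^2 \<Rightarrow> real^2^2 \<Rightarrow> real^2^2" where
  "commutator A B = A ** B - B ** A"

definition Delta :: "real^2^2 \<Rightarrow> real^2^2 \<Rightarrow> real \<Rightarrow> real" where
  "Delta A B u = (trace (A + u *\<^sub>R B))\<^sup>2 - 4 * det (A + u *\<^sub>R B)"

text \<open>On each bounded interval there are finitely many jumps, and the control is constant on
  every subinterval that avoids them. Its values at the jumps themselves are arbitrary.\<close>

definition admissible_control :: "(real \<Rightarrow> real) \<Rightarrow> bool" where
  "admissible_control u \<longleftrightarrow>
     (\<forall>a b. \<exists>J. finite J \<and>
        (\<forall>I. is_interval I \<and> I \<subseteq> {a..b} - J \<longrightarrow> u constant_on I))"

text \<open>As the right-hand side is discontinuous in time, a solution on \<open>[0, T]\<close> is a continuous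
  curve that satisfies the equation at all but finitely many times. For an admissible control and
  a given initial value it exists and is unique.\<close>

definition bilinear_solution ::
    "real^2^2 \<Rightarrow> real^2^2 \<Rightarrow> (real \<Rightarrow> real) \<Rightarrow> real \<Rightarrow> (real \<Rightarrow> real^2) \<Rightarrow> bool" where
  "bilinear_solution A B u T \<xi> \<longleftrightarrow>
     continuous_on {0..T} \<xi> \<and>
     (\<exists>J. finite J \<and>
        (\<forall>t\<in>{0..T} - J.
           (\<xi> has_vector_derivative (A + u t *\<^sub>R B) *v \<xi> t) (at t within {0..T})))"

text \<open>No condition keeps the trajectory away from the origin: by uniqueness a solution that
  starts at a nonzero point never vanishes.\<close>

definition controllable_on_punctured_plane :: "real^2^2 \<Rightarrow> real^2^2 \<Rightarrow> bool" where
  "controllable_on_punctured_plane A B \<longleftrightarrow>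
     (\<forall>x\<in>UNIV - {0}. \<forall>y\<in>UNIV - {0}. \<exists>u T \<xi>.
        admissible_control u \<and> 0 \<le> T \<and> bilinear_solution A B u T \<xi> \<and> \<xi> 0 = x \<and> \<xi> T = y)"

end

theory Submission
  imports Defs
begin

text \<open>Conditions (1)--(3) force \<open>det (A + v B) < 0\<close> for some \<open>v\<close>: the determinant is a quadratic
  form of signature (1,2) on the traceless matrices, and by (2) the traceless part of some
  \<open>A + u B\<close> is positive for it, so its Gram determinant together with \<open>B\<close>, a positive multiple of
  \<open>det [A, B]\<close>, cannot be positive. Hence \<open>det A < 0\<close> or \<open>det B < 0\<close>, and one takes \<open>v = 0\<close> or
  \<open>v\<close> large. The matrix \<open>A + v B\<close> has eigenvalues of both signs, whereas the flow of \<open>A + u B\<close>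
  moves any ray from the origin onto any other. So one can turn to an expanding eigenline, stay on
  it, turn to a contracting one, stay on it, and turn to the target ray; the two waiting times
  adjust the norm to any prescribed value.\<close>

section \<open>Reachability and concatenation of trajectories\<close>

definition reachable :: "real^2^2 \<Rightarrow> real^2^2 \<Rightarrow> real^2 \<Rightarrow> real^2 \<Rightarrow> bool" where
  "reachable A B x y \<longleftrightarrow> (\<exists>u T \<xi>.
     admissible_control u \<and> 0 \<le> T \<and> bilinear_solution A B u T \<xi> \<and> \<xi> 0 = x \<and> \<xi> T = y)"

lemma admissible_control_const: "admissible_control (\<lambda>_. c)"
  unfolding admissible_control_def constant_on_def by (intro allI exI[of _ "{}"]) auto

text \<open>Counting the switching time \<open>S\<close> as a jump makes every interval that avoids
  the jumps lie on one side of \<open>S\<close>, where the new control is \<open>u\<close> or a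
  translate of \<open>v\<close>.\<close>

lemma admissible_control_concat:
  assumes "admissible_control u" "admissible_control v"
  shows "admissible_control (\<lambda>t. if t \<le> S then u t else v (t - S))"
  unfolding admissible_control_def
proof (intro allI)
  fix a b :: real
  obtain J where J: "finite J" "\<And>I. is_interval I \<Longrightarrow> I \<subseteq> {a..b} - J \<Longrightarrow> u constant_on I"
    using assms(1) unfolding admissible_control_def by meson
  obtain K where K: "finite K"
      "\<And>I. is_interval I \<Longrightarrow> I \<subseteq> {a - S..b - S} - K \<Longrightarrow> v constant_on I"
    using assms(2) unfolding admissible_control_def by meson
  let ?w = "\<lambda>t. if t \<le> S then u t else v (t - S)"
  let ?L = "insert S (J \<union> (\<lambda>t. t + S) ` K)"
  have "?w constant_on I" if I: "is_interval I" "I \<subseteq> {a..b} - ?L" for I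
  proof -
    have "S \<notin> I" using I by auto
    then consider "\<forall>t\<in>I. t < S" | "\<forall>t\<in>I. S < t"
      using I(1) unfolding is_interval_1 by (meson linorder_not_le order_le_less)
    then show ?thesis
    proof cases
      case 1
      have "u constant_on I" using J(2) I by blast
      then show ?thesis using 1 unfolding constant_on_def by force
    next
      case 2
      let ?I = "(\<lambda>t. t - S) ` I"
      have "x \<in> ?I \<longleftrightarrow> x + S \<in> I" for x
        by (auto intro: image_eqI[of _ _ "x + S"])
      then have "is_interval ?I"
        using I(1) unfolding is_interval_1 by (meson add_right_mono)
      moreover have "?I \<subseteq> {a - S..b - S} - K" using I(2) by (force simp: image_iff)
      ultimately have "v constant_on ?I" by (rule K(2))
      then show ?thesis using 2 unfolding constant_on_def by force
    qed
  qed
  moreover have "finite ?L" using J K by auto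
  ultimately show "\<exists>L. finite L \<and>
      (\<forall>I. is_interval I \<and> I \<subseteq> {a..b} - L \<longrightarrow> ?w constant_on I)"
    by blast
qed

text \<open>The gluing time \<open>S\<close> joins the exceptional set. Near any other time the
  glued curve is \<open>\<xi>\<close> or a translate of \<open>\<eta>\<close>, so derivatives carry
  over; continuity at \<open>S\<close> comes from \<open>\<xi> S = \<eta> 0\<close>.\<close>

lemma bilinear_solution_concat:
  assumes "bilinear_solution A B u S \<xi>" "bilinear_solution A B v T \<eta>"
    and "0 \<le> S" "0 \<le> T" "\<xi> S = \<eta> 0"
  shows "bilinear_solution A B (\<lambda>t. if t \<le> S then u t else v (t - S)) (S + T)
           (\<lambda>t. if t \<le> S then \<xi> t else \<eta> (t - S))"
    (is "bilinear_solution A B ?w _ ?\<zeta>")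
proof -
  obtain J where cJ: "continuous_on {0..S} \<xi>" "finite J"
    and J: "\<And>t. t \<in> {0..S} - J \<Longrightarrow>
      (\<xi> has_vector_derivative (A + u t *\<^sub>R B) *v \<xi> t) (at t within {0..S})"
    using assms(1) unfolding bilinear_solution_def by meson
  obtain K where cK: "continuous_on {0..T} \<eta>" "finite K"
    and K: "\<And>t. t \<in> {0..T} - K \<Longrightarrow>
      (\<eta> has_vector_derivative (A + v t *\<^sub>R B) *v \<eta> t) (at t within {0..T})"
    using assms(2) unfolding bilinear_solution_def by meson
  let ?L = "insert S (J \<union> (\<lambda>t. t + S) ` K)"
  have un: "{0..S + T} = {0..S} \<union> {S..S + T}" using assms by auto
  have shift: "(\<lambda>t. t - S) ` {S..S + T} = {0..T}" by simp
  have "continuous_on {S..S + T} (\<lambda>t. \<eta> (t - S))"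
    using cK(1) by (intro continuous_on_compose2[OF cK(1)] continuous_intros) auto
  then have "continuous_on {0..S + T} ?\<zeta>"
    unfolding un using cJ(1) assms(5)
    by (intro continuous_on_cases) auto
  moreover have "(?\<zeta> has_vector_derivative (A + ?w t *\<^sub>R B) *v ?\<zeta> t) (at t within {0..S + T})"
    if t: "t \<in> {0..S + T} - ?L" for t
  proof (cases "t < S")
    case True
    have "(\<xi> has_vector_derivative (A + u t *\<^sub>R B) *v \<xi> t) (at t within {0..S})"
      using t True by (intro J) auto
    moreover have "at t within {0..S} = at t within {0..S + T}"
      using True assms by (intro at_within_nhd[of _ "{..<S}"]) auto
    ultimately have "(\<xi> has_vector_derivative (A + u t *\<^sub>R B) *v \<xi> t) (at t within {0..S + T})"
      by simp
    then have "(?\<zeta> has_vector_derivative (A + u t *\<^sub>R B) *v \<xi> t) (at t within {0..S + T})"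
      by (rule has_vector_derivative_transform_within[where d = "S - t"])
         (use t True in \<open>auto simp: dist_real_def\<close>)
    then show ?thesis using True by simp
  next
    case False
    then have St: "S < t" using t by auto
    have "(\<eta> has_vector_derivative (A + v (t - S) *\<^sub>R B) *v \<eta> (t - S)) (at (t - S) within {0..T})"
      using t St by (intro K) (force simp: image_iff)
    then have "((\<eta> \<circ> (\<lambda>t. t - S)) has_vector_derivative
        1 *\<^sub>R ((A + v (t - S) *\<^sub>R B) *v \<eta> (t - S))) (at t within {S..S + T})"
      by (intro vector_diff_chain_within)
         (auto simp: shift has_vector_derivative_def intro!: derivative_eq_intros)
    moreover have "at t within {S..S + T} = at t within {0..S + T}"
      using St assms by (intro at_within_nhd[of _ "{S<..}"]) auto
    ultimately have "((\<eta> \<circ> (\<lambda>t. t - S)) has_vector_derivative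
        (A + v (t - S) *\<^sub>R B) *v \<eta> (t - S)) (at t within {0..S + T})"
      by simp
    then have "(?\<zeta> has_vector_derivative (A + v (t - S) *\<^sub>R B) *v \<eta> (t - S))
        (at t within {0..S + T})"
      by (rule has_vector_derivative_transform_within[where d = "t - S"])
         (use t St in \<open>auto simp: dist_real_def\<close>)
    then show ?thesis using St by simp
  qed
  moreover have "finite ?L" using cJ cK by auto
  ultimately show ?thesis unfolding bilinear_solution_def by blast
qed

lemma reachable_trans [trans]:
  assumes "reachable A B x y" "reachable A B y z"
  shows "reachable A B x z"
proof -
  obtain u S \<xi> where 1: "admissible_control u" "0 \<le> S" "bilinear_solution A B u S \<xi>"
      "\<xi> 0 = x" "\<xi> S = y"
    using assms(1) unfolding reachable_def by blast
  obtain v T \<eta> where 2: "admissible_control v" "0 \<le> T" "bilinear_solution A B v T \<eta>"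
      "\<eta> 0 = y" "\<eta> T = z"
    using assms(2) unfolding reachable_def by blast
  \<comment> \<open>The end time falls into the first branch only for \<open>T = 0\<close>, and then
    \<open>\<xi> S = y = \<eta> 0 = z\<close>.\<close>
  have "(if S + T \<le> S then \<xi> (S + T) else \<eta> (S + T - S)) = z"
    using 1 2 by (cases "T = 0") auto
  moreover have "0 \<le> S + T" using 1 2 by simp
  ultimately show ?thesis
    unfolding reachable_def
    using admissible_control_concat[OF 1(1) 2(1), of S] 1 2
      bilinear_solution_concat[OF 1(3) 2(3) 1(2) 2(2)]
    by (intro exI[of _ "\<lambda>t. if t \<le> S then u t else v (t - S)"] exI[of _ "S + T"]
        exI[of _ "\<lambda>t. if t \<le> S then \<xi> t else \<eta> (t - S)"]) auto
qed

lemma reachable_const_control: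
  assumes "\<And>t. (\<xi> has_vector_derivative (A + u *\<^sub>R B) *v \<xi> t) (at t)" "0 \<le> T"
  shows "reachable A B (\<xi> 0) (\<xi> T)"
proof -
  have "continuous_on {0..T} \<xi>"
    using assms(1) by (meson continuous_at_imp_continuous_on has_vector_derivative_continuous)
  then have "bilinear_solution A B (\<lambda>_. u) T \<xi>"
    unfolding bilinear_solution_def
    by (auto intro!: exI[of _ "{}"] has_vector_derivative_at_within assms(1))
  then show ?thesis
    unfolding reachable_def using admissible_control_const assms(2) by blast
qed

lemma reachable_eigenvector:
  assumes "(A + u *\<^sub>R B) *v x = l *\<^sub>R x" "0 \<le> T"
  shows "reachable A B x (exp (l * T) *\<^sub>R x)"
proof -
  have "((\<lambda>t. exp (l * t) *\<^sub>R x) has_vector_derivative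
      (A + u *\<^sub>R B) *v (exp (l * t) *\<^sub>R x)) (at t)" for t
    by (auto intro!: derivative_eq_intros simp: assms(1) matrix_vector_mult_scaleR)
  from reachable_const_control[OF this assms(2)] show ?thesis by simp
qed

section \<open>The flow of a matrix without real eigenvalues\<close>

text \<open>Cayley-Hamilton for the traceless part of \<open>M\<close>: its square is minus its
  determinant, a quarter of the discriminant of the characteristic polynomial.\<close>

lemma traceless_part_square:
  fixes M :: "real^2^2" and x :: "real^2"
  defines "N \<equiv> \<lambda>x. M *v x - (trace M / 2) *\<^sub>R x"
  shows "N (N x) = (((trace M)\<^sup>2 - 4 * det M) / 4) *\<^sub>R x"
  unfolding N_def
  by (simp add: vec_eq_iff forall_2 matrix_vector_mult_def sum_2 trace_def det_2 field_simps
      power2_eq_square)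

text \<open>Without a real eigenvalue no line is invariant, so \<open>x\<close> and its image under
  the traceless part of \<open>M\<close> form a basis of the plane.\<close>

lemma elliptic_cyclic:
  fixes M :: "real^2^2" and x y :: "real^2"
  assumes "(trace M)\<^sup>2 - 4 * det M < 0" "x \<noteq> 0"
  obtains p q where "y = p *\<^sub>R x + q *\<^sub>R (M *v x - (trace M / 2) *\<^sub>R x)"
proof -
  define w where "w = M *v x - (trace M / 2) *\<^sub>R x"
  define D where "D = x$1 * w$2 - x$2 * w$1"
  define a where "a = (M$1$1 - M$2$2) / 2"
  have disc: "a\<^sup>2 + M$1$2 * M$2$1 < 0"
    using assms(1) by (simp add: a_def trace_def sum_2 det_2 power2_eq_square field_simps)
  \<comment> \<open>\<open>D\<close> is a quadratic form in \<open>x\<close>. Completing the square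
    shows it to be definite, since both summands on the right are nonnegative by
    \<open>disc\<close>.\<close>
  have cD: "M$2$1 * D = (M$2$1 * x$1 - a * x$2)\<^sup>2 - (a\<^sup>2 + M$1$2 * M$2$1) * (x$2)\<^sup>2"
    by (simp add: D_def w_def a_def matrix_vector_mult_def trace_def sum_2 power2_eq_square
        field_simps)
  have "D \<noteq> 0"
  proof
    assume "D = 0"
    moreover have "(a\<^sup>2 + M$1$2 * M$2$1) * (x$2)\<^sup>2 \<le> 0"
      using disc by (simp add: mult_nonpos_nonneg)
    ultimately have "(M$2$1 * x$1 - a * x$2)\<^sup>2 = 0" "(a\<^sup>2 + M$1$2 * M$2$1) * (x$2)\<^sup>2 = 0"
      using cD zero_le_power2[of "M$2$1 * x$1 - a * x$2"] by auto
    then have "x$2 = 0" "M$2$1 * x$1 = 0" using disc by auto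
    moreover have "M$2$1 \<noteq> 0" using disc by auto
    ultimately show False using assms(2) by (auto simp: vec_eq_iff forall_2)
  qed
  \<comment> \<open>Cramer's rule in the basis \<open>x\<close>, \<open>w\<close>.\<close>
  then have "y = ((y$1 * w$2 - y$2 * w$1) / D) *\<^sub>R x + ((x$1 * y$2 - x$2 * y$1) / D) *\<^sub>R w"
    by (simp add: vec_eq_iff forall_2 field_simps) (simp add: D_def algebra_simps)
  then show ?thesis using that unfolding w_def by blast
qed

text \<open>In the basis \<open>x\<close>, \<open>N x\<close> the flow is a rotation times a scalar
  exponential, so it sweeps out all directions. By linearity \<open>r\<close> does not depend on
  \<open>c\<close>, which allows such moves to be chained.\<close>

lemma reachable_ray:
  assumes "Delta A B u < 0" "x \<noteq> 0" "y \<noteq> 0"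
  obtains r where "0 < r" "\<And>c. reachable A B (c *\<^sub>R x) ((c * r) *\<^sub>R y)"
proof -
  define M where "M = A + u *\<^sub>R B"
  define N where "N = (\<lambda>x. M *v x - (trace M / 2) *\<^sub>R x)"
  define a where "a = trace M / 2"
  define b where "b = sqrt (- ((trace M)\<^sup>2 - 4 * det M)) / 2"
  have neg: "(trace M)\<^sup>2 - 4 * det M < 0"
    using assms(1) by (simp add: Delta_def M_def)
  then have b: "0 < b" "b\<^sup>2 = - ((trace M)\<^sup>2 - 4 * det M) / 4"
    by (auto simp: b_def power_divide)
  have NN: "N (N z) = - (b\<^sup>2) *\<^sub>R z" for z
  proof -
    have "- (b\<^sup>2) = ((trace M)\<^sup>2 - 4 * det M) / 4" using b(2) by simp
    then show ?thesis unfolding N_def by (simp only: traceless_part_square)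
  qed
  have M_eq: "M *v z = a *\<^sub>R z + N z" for z by (simp add: N_def a_def)
  have N_lin: "N (p *\<^sub>R w + q *\<^sub>R z) = p *\<^sub>R N w + q *\<^sub>R N z" for p q w z
    by (simp add: N_def matrix_vector_right_distrib matrix_vector_mult_scaleR algebra_simps)
  have N_scale: "N (p *\<^sub>R w) = p *\<^sub>R N w" for p w
    using N_lin[of p w 0 w] by simp
  \<comment> \<open>This is \<open>exp (t M) z\<close>: by \<open>NN\<close>, \<open>N / b\<close>
    behaves like the imaginary unit and commutes with the scalar part \<open>a\<close>.\<close>
  define \<xi> where "\<xi> = (\<lambda>z t. exp (a * t) *\<^sub>R (cos (b * t) *\<^sub>R z + (sin (b * t) / b) *\<^sub>R N z))"
  have deriv: "(\<xi> z has_vector_derivative (A + u *\<^sub>R B) *v \<xi> z t) (at t)" for z t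
  proof -
    have "(\<xi> z has_vector_derivative a *\<^sub>R \<xi> z t +
        exp (a * t) *\<^sub>R ((- (b * sin (b * t))) *\<^sub>R z + cos (b * t) *\<^sub>R N z)) (at t)"
      unfolding \<xi>_def using b(1)
      by (auto intro!: derivative_eq_intros simp: algebra_simps add_divide_distrib)
    moreover have "N (\<xi> z t) = exp (a * t) *\<^sub>R ((- (b * sin (b * t))) *\<^sub>R z + cos (b * t) *\<^sub>R N z)"
      using b(1) by (simp add: \<xi>_def N_scale N_lin NN power2_eq_square)
    ultimately show ?thesis by (simp add: M_def[symmetric] M_eq)
  qed
  obtain p q where pq: "y = p *\<^sub>R x + q *\<^sub>R N x"
    using elliptic_cyclic[OF neg assms(2)] unfolding N_def by blast
  \<comment> \<open>Polar coordinates of \<open>y\<close> in the basis \<open>x\<close>,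
    \<open>N x / b\<close>. The angle \<open>\<theta>\<close> is taken nonnegative, so that
    \<open>\<theta> / b\<close> is an admissible time.\<close>
  define \<rho> where "\<rho> = sqrt (p\<^sup>2 + (b * q)\<^sup>2)"
  have "p \<noteq> 0 \<or> b * q \<noteq> 0" using pq assms(3) b(1) by auto
  then have sq: "0 < p\<^sup>2 + (b * q)\<^sup>2" by (simp add: sum_power2_gt_zero_iff)
  then have \<rho>: "0 < \<rho>" "\<rho>\<^sup>2 = p\<^sup>2 + (b * q)\<^sup>2" by (auto simp: \<rho>_def)
  have "(p / \<rho>)\<^sup>2 + (b * q / \<rho>)\<^sup>2 = 1"
    using sq unfolding power_divide add_divide_distrib[symmetric] \<rho>(2)
    by (rule divide_self[OF less_imp_neq[THEN not_sym]])
  then obtain \<theta> where \<theta>: "0 \<le> \<theta>" "p / \<rho> = cos \<theta>" "b * q / \<rho> = sin \<theta>"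
    by (metis sincos_total_2pi)
  have "\<xi> (c *\<^sub>R x) (\<theta> / b) = (c * (exp (a * (\<theta> / b)) / \<rho>)) *\<^sub>R y" for c
    using b(1) \<rho>(1)
    by (simp add: \<xi>_def N_scale pq \<theta>(2,3)[symmetric] scaleR_add_right mult_ac)
  moreover have "\<xi> z 0 = z" for z by (simp add: \<xi>_def)
  moreover have "0 \<le> \<theta> / b" using \<theta>(1) b(1) by simp
  ultimately have "reachable A B (c *\<^sub>R x) ((c * (exp (a * (\<theta> / b)) / \<rho>)) *\<^sub>R y)" for c
    by (metis reachable_const_control[OF deriv])
  then show ?thesis using that[of "exp (a * (\<theta> / b)) / \<rho>"] \<rho>(1) by simp
qed

section \<open>Expanding and contracting eigenlines\<close>

lemma eigenvector_of_root:
  fixes M :: "real^2^2"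
  assumes "l\<^sup>2 - trace M * l + det M = 0"
  obtains v where "v \<noteq> 0" "M *v v = l *\<^sub>R v"
proof -
  have "det (M - l *\<^sub>R mat 1) = 0"
    using assms by (simp add: det_2 trace_def sum_2 mat_def power2_eq_square algebra_simps)
  then obtain v where "v \<noteq> 0" "(M - l *\<^sub>R mat 1) *v v = 0"
    by (metis invertible_det_nz invertible_left_inverse matrix_left_invertible_ker)
  then show ?thesis
    using that[of v]
    by (simp add: matrix_vector_mult_diff_rdistrib scaleR_matrix_vector_assoc[symmetric])
qed

text \<open>A negative determinant makes the discriminant exceed the squared trace, so the two roots
  of the characteristic polynomial are real with opposite signs.\<close>

lemma eigenvectors_of_det_neg:
  fixes M :: "real^2^2"
  assumes "det M < 0"
  obtains l m v w where "0 < l" "m < 0" "v \<noteq> 0" "w \<noteq> 0" "M *v v = l *\<^sub>R v" "M *v w = m *\<^sub>R w"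
proof -
  define s where "s = sqrt ((trace M)\<^sup>2 - 4 * det M)"
  have s2: "s\<^sup>2 = (trace M)\<^sup>2 - 4 * det M"
    using assms zero_le_power2[of "trace M"] unfolding s_def by (intro real_sqrt_pow2) linarith
  have "sqrt ((trace M)\<^sup>2) < s"
    unfolding s_def real_sqrt_less_iff using assms by simp
  then have "\<bar>trace M\<bar> < s" by simp
  then have sgn: "0 < (trace M + s) / 2" "(trace M - s) / 2 < 0" by auto
  have "((trace M + s) / 2)\<^sup>2 - trace M * ((trace M + s) / 2) + det M = 0"
       "((trace M - s) / 2)\<^sup>2 - trace M * ((trace M - s) / 2) + det M = 0"
    using s2 by (simp_all add: power2_eq_square field_simps)
  then show ?thesis
    using that[OF sgn] by (metis eigenvector_of_root)
qed

section \<open>Steering between arbitrary nonzero points\<close>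

lemma controllable_of_elliptic_and_det_neg:
  assumes "Delta A B u < 0" "det (A + v *\<^sub>R B) < 0"
  shows "controllable_on_punctured_plane A B"
proof -
  obtain l m e f where ev: "0 < l" "m < 0" "e \<noteq> 0" "f \<noteq> 0"
      "(A + v *\<^sub>R B) *v e = l *\<^sub>R e" "(A + v *\<^sub>R B) *v f = m *\<^sub>R f"
    using eigenvectors_of_det_neg[OF assms(2)] by metis
  have "reachable A B x y" if "x \<noteq> 0" "y \<noteq> 0" for x y
  proof -
    obtain r1 where r1: "0 < r1" "\<And>c. reachable A B (c *\<^sub>R x) ((c * r1) *\<^sub>R e)"
      using reachable_ray[OF assms(1) \<open>x \<noteq> 0\<close> ev(3)] by metis
    obtain r2 where r2: "0 < r2" "\<And>c. reachable A B (c *\<^sub>R e) ((c * r2) *\<^sub>R f)"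
      using reachable_ray[OF assms(1) ev(3,4)] by metis
    obtain r3 where r3: "0 < r3" "\<And>c. reachable A B (c *\<^sub>R f) ((c * r3) *\<^sub>R y)"
      using reachable_ray[OF assms(1) ev(4) \<open>y \<noteq> 0\<close>] by metis
    \<comment> \<open>The three turns contribute the factor \<open>r1 * r2 * r3\<close>, and
      \<open>k\<close> is the logarithm of the correction still needed. Its sign decides on which
      eigenline to wait: expanding for \<open>k \<ge> 0\<close>, contracting otherwise.\<close>
    define k where "k = - ln (r1 * r2 * r3)"
    obtain s t where st: "0 \<le> s" "0 \<le> t" "l * s + m * t = k"
    proof (cases "0 \<le> k")
      case True
      then show ?thesis using that[of "k / l" 0] ev(1) by simp
    next
      case False
      then show ?thesis using that[of 0 "k / m"] ev(2) by (simp add: divide_nonpos_neg)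
    qed
    have "exp k = 1 / (r1 * r2 * r3)"
      using r1(1) r2(1) r3(1) by (simp add: k_def exp_minus inverse_eq_divide)
    then have total: "r1 * exp (l * s) * r2 * exp (m * t) * r3 = 1"
      using r1(1) r2(1) r3(1) unfolding st(3)[symmetric] exp_add by (simp add: field_simps)
    have along_e: "reachable A B (c *\<^sub>R e) ((c * exp (l * s)) *\<^sub>R e)" for c
      using reachable_eigenvector[of A v B "c *\<^sub>R e" l s] ev(5) st(1)
      by (simp add: matrix_vector_mult_scaleR mult.commute)
    have along_f: "reachable A B (c *\<^sub>R f) ((c * exp (m * t)) *\<^sub>R f)" for c
      using reachable_eigenvector[of A v B "c *\<^sub>R f" m t] ev(6) st(2)
      by (simp add: matrix_vector_mult_scaleR mult.commute)
    have "reachable A B x (r1 *\<^sub>R e)" using r1(2)[of 1] by simp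
    also have "reachable A B (r1 *\<^sub>R e) ((r1 * exp (l * s)) *\<^sub>R e)" by (rule along_e)
    also have "reachable A B \<dots> ((r1 * exp (l * s) * r2) *\<^sub>R f)" by (rule r2(2))
    also have "reachable A B \<dots> ((r1 * exp (l * s) * r2 * exp (m * t)) *\<^sub>R f)" by (rule along_f)
    also have "reachable A B \<dots> ((r1 * exp (l * s) * r2 * exp (m * t) * r3) *\<^sub>R y)" by (rule r3(2))
    finally show ?thesis by (simp add: total)
  qed
  then show ?thesis
    unfolding controllable_on_punctured_plane_def reachable_def by simp
qed

section \<open>Signs of the determinants of the commutator and of the pencil\<close>

text \<open>For the traceless matrices \<open>N\<close> with rows \<open>(a, b)\<close>,
  \<open>(c, -a)\<close> and \<open>P\<close> with rows \<open>(p, q)\<close>,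
  \<open>(r, -p)\<close>, the right-hand side is \<open>- det [N, P]\<close>; the hypothesis says
  \<open>det N > 0\<close>.\<close>

lemma commutator_form_nonneg:
  fixes a b c p q r :: real
  assumes "a\<^sup>2 + b * c < 0"
  shows "0 \<le> (b * r - c * q)\<^sup>2 + 4 * (a * q - b * p) * (c * p - a * r)"
proof -
  define \<alpha> \<beta> w where "\<alpha> = a * q - b * p" and "\<beta> = c * p - a * r" and "w = b * r - c * q"
  have bc: "b * c < 0" using assms zero_le_power2[of a] by linarith
  \<comment> \<open>This is the identity \<open>trace (N [N, P]) = 0\<close>, where
    \<open>[N, P]\<close> has rows \<open>(w, 2 \<alpha>)\<close>,
    \<open>(2 \<beta>, -w)\<close>.\<close>
  have lin: "a * w = - (c * \<alpha> + b * \<beta>)" by (simp add: \<alpha>_def \<beta>_def w_def algebra_simps)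
  have "0 \<le> w\<^sup>2 + 4 * (\<alpha> * \<beta>)"
  proof (cases "0 \<le> \<alpha> * \<beta>")
    case False
    have "a \<noteq> 0"
    proof
      assume "a = 0"
      then have "\<alpha> * \<beta> = - (b * c) * p\<^sup>2"
        by (simp add: \<alpha>_def \<beta>_def power2_eq_square)
      then show False using bc False by (simp add: mult_nonpos_nonneg)
    qed
    \<comment> \<open>Substituting \<open>lin\<close> for \<open>a * w\<close> leaves a square plus
      a product of two negative factors.\<close>
    have "a\<^sup>2 * (w\<^sup>2 + 4 * (\<alpha> * \<beta>)) = (c * \<alpha> - b * \<beta>)\<^sup>2 + 4 * ((a\<^sup>2 + b * c) * (\<alpha> * \<beta>))"
      using arg_cong[OF lin, of "\<lambda>z. z\<^sup>2"] by (simp add: power2_eq_square algebra_simps)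
    moreover have "0 \<le> (a\<^sup>2 + b * c) * (\<alpha> * \<beta>)"
      using assms False by (intro mult_nonpos_nonpos) auto
    ultimately have "0 \<le> a\<^sup>2 * (w\<^sup>2 + 4 * (\<alpha> * \<beta>))" by simp
    then show ?thesis using \<open>a \<noteq> 0\<close> by (simp add: zero_le_mult_iff)
  qed simp
  then show ?thesis unfolding \<alpha>_def \<beta>_def w_def mult.assoc .
qed

text \<open>The commutator with \<open>B\<close> is unchanged when a multiple of \<open>B\<close> or
  a scalar matrix is added to \<open>A\<close>, so \<open>A\<close> may be replaced by the traceless
  part of the elliptic matrix \<open>A + u B\<close>.\<close>

lemma det_commutator_nonpos:
  assumes "Delta A B u < 0" "trace B = 0"
  shows "det (commutator A B) \<le> 0"
proof -
  define M where "M = A + u *\<^sub>R B"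
  define a where "a = (M$1$1 - M$2$2) / 2"
  have B22: "B$2$2 = - B$1$1" using assms(2) by (simp add: trace_def sum_2)
  have "a\<^sup>2 + M$1$2 * M$2$1 < 0"
    using assms(1) unfolding Delta_def M_def[symmetric]
    by (simp add: a_def trace_def sum_2 det_2 power2_eq_square field_simps)
  from commutator_form_nonneg[OF this, of "B$2$1" "B$1$2" "B$1$1"]
  have "0 \<le> - det (commutator M B)"
    by (simp add: commutator_def det_2 matrix_matrix_mult_def sum_2 a_def B22 power2_eq_square
        field_simps)
  moreover have "commutator M B = commutator A B"
    by (simp add: commutator_def M_def vec_eq_iff forall_2 matrix_matrix_mult_def sum_2
        algebra_simps)
  ultimately show ?thesis by simp
qed

text \<open>Along the pencil the determinant is a quadratic polynomial in \<open>v\<close> with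
  leading coefficient \<open>det B\<close>, hence negative for large \<open>v\<close>.\<close>

lemma det_pencil_neg:
  fixes A B :: "real^2^2"
  assumes "det B < 0"
  obtains v where "det (A + v *\<^sub>R B) < 0"
proof -
  define k where "k = A$1$1 * B$2$2 + B$1$1 * A$2$2 - A$1$2 * B$2$1 - B$1$2 * A$2$1"
  have eq: "det (A + v *\<^sub>R B) = det A + v * (k + v * det B)" for v
    by (simp add: det_2 k_def algebra_simps)
  \<comment> \<open>Chosen so that \<open>v * det B\<close> absorbs both \<open>k\<close> and
    \<open>det A\<close>; the summand 1 gives strictness and \<open>v \<ge> 1\<close>, so that
    multiplying the negative factor by \<open>v\<close> only lowers it.\<close>
  define v where "v = 1 + (\<bar>k\<bar> + \<bar>det A\<bar>) / (- det B)"
  have "1 \<le> v" using assms by (simp add: v_def divide_nonneg_neg)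
  have "v * det B = det B - \<bar>k\<bar> - \<bar>det A\<bar>"
    using assms by (simp add: v_def field_simps)
  then have "k + v * det B < - \<bar>det A\<bar>" using assms by linarith
  moreover from this have "v * (k + v * det B) \<le> 1 * (k + v * det B)"
    using \<open>1 \<le> v\<close> by (intro mult_right_mono_neg) auto
  ultimately have "v * (k + v * det B) < - \<bar>det A\<bar>" by (simp only: mult_1)
  then have "det (A + v *\<^sub>R B) < 0" unfolding eq using abs_ge_self[of "det A"] by simp
  then show ?thesis using that by blast
qed

theorem theorem4p2:
  fixes A B :: "real^2^2"
  assumes "det A * det (commutator A B) > 0 \<or> det B * det (commutator A B) > 0"
    and "\<exists>u. Delta A B u < 0"
    and "trace B = 0"
  shows "controllable_on_punctured_plane A B"
proof -
  obtain u where u: "Delta A B u < 0" using assms(2) by blast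
  have "det (commutator A B) \<le> 0" using det_commutator_nonpos[OF u assms(3)] .
  then consider "det A < 0" | "det B < 0"
    using assms(1) by (auto simp: zero_less_mult_iff)
  then obtain v where "det (A + v *\<^sub>R B) < 0"
  proof cases
    case 1
    then show ?thesis using that[of 0] by simp
  next
    case 2
    then show ?thesis using that det_pencil_neg by blast
  qed
  with u show ?thesis by (rule controllable_of_elliptic_and_det_neg)
qed

end
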